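(* Let $n\ge 2$, let $P=(p_1,\dots,p_n)$ and $Q=(q_1,\dots,q_n)$ be elements of $\Gamma_n$, and let $r,R$ be real numbers with $0<r\le \frac{p_i}{q_i}\le R<\infty$ for all $i\in\{1,\dots,n\}$. Then $$\frac{r^2(r+3)}{(r+1)^3}\,J(P\|Q)\le D(P\|Q)\le \frac{R^2(R+3)}{(R+1)^3}\,J(P\|Q).$$
   Context: $\Gamma_n=\{P=(p_1,\dots,p_n): p_i>0,\ \sum_{i=1}^n p_i=1\}$ is the set of finite discrete probability distributions with strictly positive entries. $\ln$ is the natural logarithm. The relative J-divergence is $D(P\|Q)=\sum_{i=1}^n (p_i-q_i)\ln\left(\frac{p_i+q_i}{2q_i}\right)$. The J-divergence is $J(P\|Q)=\sum_{i=1}^n (p_i-q_i)\ln\left(\frac{p_i}{q_i}\right)$. *)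

theory Defs
  imports "HOL-Analysis.Analysis"
begin

definition Gamma_dist :: "(real ^ 'n) set" where
  "Gamma_dist = {P. (\<forall>i. P $ i > 0) \<and> (\<Sum>i\<in>UNIV. P $ i) = 1}"

definition relative_J_divergence :: "real ^ 'n \<Rightarrow> real ^ 'n \<Rightarrow> real" where
  "relative_J_divergence P Q =
     (\<Sum>i\<in>UNIV. (P $ i - Q $ i) * ln ((P $ i + Q $ i) / (2 * Q $ i)))"

definition J_divergence :: "real ^ 'n \<Rightarrow> real ^ 'n \<Rightarrow> real" where
  "J_divergence P Q = (\<Sum>i\<in>UNIV. (P $ i - Q $ i) * ln (P $ i / Q $ i))"

end

theory Submission
  imports Defs
begin

text \<open>Put \<open>f x = (x - 1) * ln ((x + 1) / 2)\<close> and \<open>g x = (x - 1) * ln x\<close>, so that the two divergences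
  are the sums of \<open>q\<^sub>i * f (p\<^sub>i / q\<^sub>i)\<close> and \<open>q\<^sub>i * g (p\<^sub>i / q\<^sub>i)\<close>. Both \<open>f\<close> and \<open>g\<close> vanish together with their
  first derivatives at 1, and \<open>f'' x / g'' x = x\<^sup>2 * (x + 3) / (x + 1) ^ 3\<close> is increasing. Since
  \<open>r \<le> 1 \<le> R\<close>, integrating the bounds on \<open>f''\<close> twice from 1 already gives the inequalities
  termwise.\<close>

text \<open>The difference \<open>g - f\<close> has nonnegative second derivative, hence is convex
  on \<open>A\<close> and lies above its tangent at \<open>a\<close>, which is the zero line.
  Tangents lie below on both sides, so \<open>x\<close> may be on either side of
  \<open>a\<close>.\<close>

lemma le_if_second_deriv_le:
  fixes f f' f'' g g' g'' :: "real \<Rightarrow> real"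
  assumes "convex A" "a \<in> A" "x \<in> A"
    and f': "\<And>y. y \<in> A \<Longrightarrow> (f has_real_derivative f' y) (at y)"
    and f'': "\<And>y. y \<in> A \<Longrightarrow> (f' has_real_derivative f'' y) (at y)"
    and g': "\<And>y. y \<in> A \<Longrightarrow> (g has_real_derivative g' y) (at y)"
    and g'': "\<And>y. y \<in> A \<Longrightarrow> (g' has_real_derivative g'' y) (at y)"
    and le: "\<And>y. y \<in> A \<Longrightarrow> f'' y \<le> g'' y"
    and "f a = g a" "f' a = g' a"
  shows "f x \<le> g x"
proof -
  have "(g' a - f' a) * (x - a) \<le> (g x - f x) - (g a - f a)"
    by (rule f''_imp_f'[OF assms(1), where f'' = "\<lambda>y. g'' y - f'' y"])
      (use assms in \<open>auto intro!: DERIV_diff\<close>)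
  with assms(9,10) show ?thesis by simp
qed

text \<open>The derivative of the ratio simplifies to \<open>6 * t / (t + 1) ^ 4\<close>, which is
  positive for \<open>t > 0\<close>.\<close>

lemma second_deriv_ratio_mono:
  fixes x y :: real
  assumes "0 < x" "x \<le> y"
  shows "x\<^sup>2 * (x + 3) / (x + 1) ^ 3 \<le> y\<^sup>2 * (y + 3) / (y + 1) ^ 3"
proof -
  define \<phi> where "\<phi> = (\<lambda>t::real. t\<^sup>2 * (t + 3) / (t + 1) ^ 3)"
  have "\<exists>d. (\<phi> has_real_derivative d) (at t) \<and> 0 \<le> d" if "x \<le> t" "t \<le> y" for t
  proof -
    have "t > 0" using that assms by simp
    then have "(\<phi> has_real_derivative 6 * t / (t + 1) ^ 4) (at t)"
      unfolding \<phi>_def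
      apply (auto intro!: derivative_eq_intros)
      apply (simp add: divide_simps)
      apply algebra
      done
    with \<open>t > 0\<close> show ?thesis by (intro exI[of _ "6 * t / (t + 1) ^ 4"]) simp
  qed
  then show ?thesis
    using DERIV_nonneg_imp_nondecreasing[OF assms(2), of \<phi>] unfolding \<phi>_def by blast
qed

definition rel_J_fun :: "real \<Rightarrow> real" where
  "rel_J_fun x = (x - 1) * ln ((x + 1) / 2)"

definition J_fun :: "real \<Rightarrow> real" where
  "J_fun x = (x - 1) * ln x"

definition rel_J_fun' :: "real \<Rightarrow> real" where
  "rel_J_fun' x = ln ((x + 1) / 2) + (x - 1) / (x + 1)"

definition J_fun' :: "real \<Rightarrow> real" where
  "J_fun' x = ln x + (x - 1) / x"

lemma vanish_at_one: "rel_J_fun 1 = 0" "J_fun 1 = 0" "rel_J_fun' 1 = 0" "J_fun' 1 = 0"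
  by (simp_all add: rel_J_fun_def J_fun_def rel_J_fun'_def J_fun'_def)

lemma DERIV_rel_J_fun:
  assumes "x > 0"
  shows "(rel_J_fun has_real_derivative rel_J_fun' x) (at x)"
proof -
  have "((\<lambda>x. (x - 1) * ln ((x + 1) / 2)) has_real_derivative
      ln ((x + 1) / 2) + (x - 1) / (x + 1)) (at x)"
    using assms by (auto intro!: derivative_eq_intros simp flip: distrib_right)
      (simp add: divide_simps algebra_simps)
  then show ?thesis by (simp only: rel_J_fun_def [abs_def] rel_J_fun'_def)
qed

lemma DERIV_J_fun:
  assumes "x > 0"
  shows "(J_fun has_real_derivative J_fun' x) (at x)"
  unfolding J_fun_def [abs_def] J_fun'_def using assms
  by (auto intro!: derivative_eq_intros)

lemma DERIV_J_fun':
  assumes "x > 0"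
  shows "(J_fun' has_real_derivative (x + 1) / x\<^sup>2) (at x)"
proof -
  have "((\<lambda>x. ln x + (x - 1) / x) has_real_derivative 1 / x + (1 * x - (x - 1) * 1) / (x * x)) (at x)"
    using assms by (auto intro!: derivative_eq_intros)
  moreover have "1 / x + (1 * x - (x - 1) * 1) / (x * x) = (x + 1) / x\<^sup>2"
    using assms by (simp add: field_simps power2_eq_square)
  ultimately show ?thesis by (simp add: J_fun'_def [abs_def])
qed

text \<open>The derivative is just \<open>(x + 3) / (x + 1)\<^sup>2\<close>; it is written as the
  ratio times the derivative of \<open>J_fun'\<close> so that a bound on the ratio alone compares
  the two second derivatives.\<close>

lemma DERIV_rel_J_fun':
  assumes "x > 0"
  shows "(rel_J_fun' has_real_derivative
    x\<^sup>2 * (x + 3) / (x + 1) ^ 3 * ((x + 1) / x\<^sup>2)) (at x)"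
proof -
  have "((\<lambda>x. ln ((x + 1) / 2) + (x - 1) / (x + 1)) has_real_derivative
      1 / (x + 1) + (1 * (x + 1) - (x - 1) * 1) / ((x + 1) * (x + 1))) (at x)"
    using assms by (auto intro!: derivative_eq_intros simp flip: distrib_right)
      (simp add: divide_simps)
  moreover have "1 / (x + 1) + (1 * (x + 1) - (x - 1) * 1) / ((x + 1) * (x + 1)) =
      (x + 3) / (x + 1)\<^sup>2"
    using assms by (simp add: divide_simps power2_eq_square)
  moreover have "x\<^sup>2 * (x + 3) / (x + 1) ^ 3 * ((x + 1) / x\<^sup>2) = (x + 3) / (x + 1)\<^sup>2"
    using assms by (simp add: divide_simps power2_eq_square power3_eq_cube)
  ultimately show ?thesis by (simp only: rel_J_fun'_def [abs_def])
qed

text \<open>On \<open>{r..}\<close> the increasing ratio is at least its value at \<open>r\<close>,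
  and \<open>r \<le> 1\<close> puts the base point 1 into this set.\<close>

lemma rel_J_fun_lower:
  assumes "0 < r" "r \<le> 1" "r \<le> x"
  shows "r\<^sup>2 * (r + 3) / (r + 1) ^ 3 * J_fun x \<le> rel_J_fun x"
proof (rule le_if_second_deriv_le[where A = "{r..}" and a = 1
      and f' = "\<lambda>y. r\<^sup>2 * (r + 3) / (r + 1) ^ 3 * J_fun' y"
      and f'' = "\<lambda>y. r\<^sup>2 * (r + 3) / (r + 1) ^ 3 * ((y + 1) / y\<^sup>2)"
      and g = rel_J_fun and g' = rel_J_fun'
      and g'' = "\<lambda>y. y\<^sup>2 * (y + 3) / (y + 1) ^ 3 * ((y + 1) / y\<^sup>2)"
      and f = "\<lambda>y. r\<^sup>2 * (r + 3) / (r + 1) ^ 3 * J_fun y"])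
\<comment> \<open>The deleted simp rules would merge the factors into one fraction and destroy the
  product shape that \<open>DERIV_cmult\<close> and \<open>mult_right_mono\<close> match.\<close>
qed (use assms in \<open>auto intro!: DERIV_cmult DERIV_rel_J_fun DERIV_rel_J_fun' DERIV_J_fun DERIV_J_fun'
    mult_right_mono second_deriv_ratio_mono
    simp: vanish_at_one simp del: times_divide_eq_right times_divide_eq_left\<close>)

text \<open>Now the ratio is at most its value at \<open>R\<close>. The set \<open>{0<..R}\<close>
  leaves out 0 because the derivatives are available only at positive points.\<close>

lemma rel_J_fun_upper:
  assumes "1 \<le> R" "0 < x" "x \<le> R"
  shows "rel_J_fun x \<le> R\<^sup>2 * (R + 3) / (R + 1) ^ 3 * J_fun x"
proof (rule le_if_second_deriv_le[where A = "{0<..R}" and a = 1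
      and g' = "\<lambda>y. R\<^sup>2 * (R + 3) / (R + 1) ^ 3 * J_fun' y"
      and g'' = "\<lambda>y. R\<^sup>2 * (R + 3) / (R + 1) ^ 3 * ((y + 1) / y\<^sup>2)"
      and f = rel_J_fun and f' = rel_J_fun'
      and f'' = "\<lambda>y. y\<^sup>2 * (y + 3) / (y + 1) ^ 3 * ((y + 1) / y\<^sup>2)"
      and g = "\<lambda>y. R\<^sup>2 * (R + 3) / (R + 1) ^ 3 * J_fun y"])
qed (use assms in \<open>auto intro!: DERIV_cmult DERIV_rel_J_fun DERIV_rel_J_fun' DERIV_J_fun DERIV_J_fun'
    mult_right_mono second_deriv_ratio_mono
    simp: vanish_at_one simp del: times_divide_eq_right times_divide_eq_left\<close>)

lemma J_divergence_eq_sum_J_fun: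
  assumes "Q \<in> Gamma_dist"
  shows "J_divergence P Q = (\<Sum>i\<in>UNIV. Q $ i * J_fun (P $ i / Q $ i))"
  unfolding J_divergence_def
proof (rule sum.cong[OF refl])
  fix i
  have "Q $ i > 0" using assms by (simp add: Gamma_dist_def)
  then show "(P $ i - Q $ i) * ln (P $ i / Q $ i) = Q $ i * J_fun (P $ i / Q $ i)"
    by (simp add: J_fun_def right_diff_distrib flip: mult.assoc)
qed

lemma relative_J_divergence_eq_sum_rel_J_fun:
  assumes "Q \<in> Gamma_dist"
  shows "relative_J_divergence P Q = (\<Sum>i\<in>UNIV. Q $ i * rel_J_fun (P $ i / Q $ i))"
  unfolding relative_J_divergence_def
proof (rule sum.cong[OF refl])
  fix i
  have q: "Q $ i > 0" using assms by (simp add: Gamma_dist_def)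
  then have "(P $ i + Q $ i) / (2 * Q $ i) = (P $ i / Q $ i + 1) / 2"
    by (simp add: divide_simps)
  then show "(P $ i - Q $ i) * ln ((P $ i + Q $ i) / (2 * Q $ i)) =
      Q $ i * rel_J_fun (P $ i / Q $ i)"
    using q by (simp only: rel_J_fun_def) (simp add: right_diff_distrib flip: mult.assoc)
qed

theorem proposition4p2:
  fixes P Q :: "real ^ 'n" and r R :: real
  assumes "CARD('n) \<ge> 2"
    and "P \<in> Gamma_dist" and "Q \<in> Gamma_dist"
    and "0 < r"
    and "\<And>i. r \<le> P $ i / Q $ i" and "\<And>i. P $ i / Q $ i \<le> R"
  shows "r\<^sup>2 * (r + 3) / (r + 1) ^ 3 * J_divergence P Q \<le> relative_J_divergence P Q
     \<and> relative_J_divergence P Q \<le> R\<^sup>2 * (R + 3) / (R + 1) ^ 3 * J_divergence P Q"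
proof -
  have q: "Q $ i > 0" for i using assms(3) by (simp add: Gamma_dist_def)
  have x: "P $ i / Q $ i > 0" for i using assms(4) assms(5)[of i] by linarith
  have sums: "(\<Sum>i\<in>UNIV. P $ i) = 1" "(\<Sum>i\<in>UNIV. Q $ i) = 1"
    using assms(2,3) by (auto simp: Gamma_dist_def)
  \<comment> \<open>Summing \<open>r * Q $ i \<le> P $ i\<close> over two distributions of total
    mass 1 leaves \<open>r \<le> 1\<close>; the bound on \<open>R\<close> arises in the same
    way.\<close>
  have "(\<Sum>i\<in>UNIV. r * Q $ i) \<le> (\<Sum>i\<in>UNIV. P $ i)"
    using assms(5) q by (intro sum_mono) (simp add: pos_le_divide_eq)
  then have r: "r \<le> 1" by (simp add: sums flip: sum_distrib_left)
  have "(\<Sum>i\<in>UNIV. P $ i) \<le> (\<Sum>i\<in>UNIV. R * Q $ i)"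
    using assms(6) q by (intro sum_mono) (simp add: pos_divide_le_eq)
  then have R: "1 \<le> R" by (simp add: sums flip: sum_distrib_left)
  show ?thesis
    \<comment> \<open>The constant moves into the sum and then behind the weight
      \<open>Q $ i\<close>, so that the claim reduces to the pointwise bounds at
      \<open>P $ i / Q $ i\<close>.\<close>
    unfolding J_divergence_eq_sum_J_fun[OF assms(3)]
      relative_J_divergence_eq_sum_rel_J_fun[OF assms(3)]
      sum_distrib_left mult.left_commute[of _ "Q $ _"]
    using rel_J_fun_lower[OF assms(4) r assms(5)] rel_J_fun_upper[OF R x assms(6)]
    by (intro conjI sum_mono mult_left_mono) (use q in \<open>auto intro: less_imp_le\<close>)
qed

end
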